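(* Let $U$ be a finite set and let $\mathbf{C}$ be a covering of $U$. Then the partially ordered set $\langle \mathbb{D}(U,\mathbf{C}), \subseteq\rangle$ of all definable sets with respect to $\mathbf{C}$, ordered by inclusion, is a lattice.
   Context: A covering $\mathbf{C}$ of $U$ is a family of nonempty subsets of $U$ with $\bigcup\mathbf{C}=U$. For $x\in U$, the neighborhood of $x$ is $N_{\mathbf{C}}(x)=\bigcap\{K\in\mathbf{C}: x\in K\}$. A subset $X\subseteq U$ is called a definable set with respect to $\mathbf{C}$ if $X=\bigcup_{x\in X}N_{\mathbf{C}}(x)$; in particular $\emptyset$ is definable. $\mathbb{D}(U,\mathbf{C})$ denotes the family of all definable sets with respect to $\mathbf{C}$. A partially ordered set is a lattice if any two of its elements have a least upper bound and a greatest lower bound. *)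

theory Defs
  imports "HOL-Algebra.Lattice"
begin

definition covering :: "'a set \<Rightarrow> 'a set set \<Rightarrow> bool" where
  "covering U C \<longleftrightarrow> (\<forall>K\<in>C. K \<noteq> {} \<and> K \<subseteq> U) \<and> \<Union>C = U"

text \<open>Meaningful only for \<open>x \<in> \<Union>C\<close>; elsewhere the intersection of the empty family is \<open>UNIV\<close>.\<close>

definition neighborhood :: "'a set set \<Rightarrow> 'a \<Rightarrow> 'a set" where
  "neighborhood C x = \<Inter>{K \<in> C. x \<in> K}"

definition definable_sets :: "'a set \<Rightarrow> 'a set set \<Rightarrow> 'a set set" where
  "definable_sets U C = {X. X \<subseteq> U \<and> X = (\<Union>x\<in>X. neighborhood C x)}"

definition inclusion_order :: "'a set set \<Rightarrow> 'a set gorder" where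
  "inclusion_order D = \<lparr>carrier = D, eq = (=), le = (\<subseteq>)\<rparr>"

end

(* A set is definable iff it contains the neighborhood of each of its points, a condition
   preserved by binary unions and intersections; these are therefore the suprema and infima. *)

theory Submission
  imports Defs
begin

text \<open>Since \<open>x\<close> always lies in \<open>neighborhood C x\<close>, one inclusion in
  the defining equation is automatic; what remains is closure under neighborhoods. Hence the
  definable sets form a sublattice of the power set of \<open>U\<close>, and
  \<open>lattice_inclusion_order\<close> applies.\<close>

lemma definable_sets_iff:
  "X \<in> definable_sets U C \<longleftrightarrow> X \<subseteq> U \<and> (\<forall>x\<in>X. neighborhood C x \<subseteq> X)"
  by (auto simp: definable_sets_def neighborhood_def)

lemma definable_sets_Un:
  "X \<in> definable_sets U C \<Longrightarrow> Y \<in> definable_sets U C \<Longrightarrow> X \<union> Y \<in> definable_sets U C"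
  by (auto simp: definable_sets_iff)

lemma definable_sets_Int:
  "X \<in> definable_sets U C \<Longrightarrow> Y \<in> definable_sets U C \<Longrightarrow> X \<inter> Y \<in> definable_sets U C"
  by (auto simp: definable_sets_iff)

lemma partial_order_inclusion_order: "partial_order (inclusion_order D)"
  by unfold_locales (auto simp: inclusion_order_def)

text \<open>Union and intersection are already the extremal bounds among all sets, so they remain so
  within any family \<open>D\<close> that contains them.\<close>

lemma lattice_inclusion_order:
  assumes Un: "\<And>X Y. X \<in> D \<Longrightarrow> Y \<in> D \<Longrightarrow> X \<union> Y \<in> D"
    and Int: "\<And>X Y. X \<in> D \<Longrightarrow> Y \<in> D \<Longrightarrow> X \<inter> Y \<in> D"
  shows "lattice (inclusion_order D)"
proof -
  interpret partial_order "inclusion_order D"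
    by (rule partial_order_inclusion_order)
  show ?thesis
  \<comment> \<open>The interpreted order axioms leave only the existence of binary suprema and
    infima.\<close>
  proof
    fix X Y
    assume XY: "X \<in> carrier (inclusion_order D)" "Y \<in> carrier (inclusion_order D)"
    have "least (inclusion_order D) (X \<union> Y) (Upper (inclusion_order D) {X, Y})"
      using XY Un by (auto simp: least_def Upper_def inclusion_order_def)
    then show "\<exists>S. least (inclusion_order D) S (Upper (inclusion_order D) {X, Y})" ..
    have "greatest (inclusion_order D) (X \<inter> Y) (Lower (inclusion_order D) {X, Y})"
      using XY Int by (auto simp: greatest_def Lower_def inclusion_order_def)
    then show "\<exists>I. greatest (inclusion_order D) I (Lower (inclusion_order D) {X, Y})" ..
  qed
qed

theorem proposition2:
  fixes U :: "'a set" and C :: "'a set set"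
  assumes "finite U" and "covering U C"
  shows "lattice (inclusion_order (definable_sets U C))"
  by (intro lattice_inclusion_order definable_sets_Un definable_sets_Int)

end
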